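(* Let $G=(V,E)$ be a finite connected graph that admits a perfect matching. Then $\eta(G)=0$ if and only if there is an edge $e\in E$ that is not contained in any perfect matching of $G$.
   Context: For a graph $G=(V,E)$ admitting a perfect matching, a weight function is a map $w:E\to\mathbb{R}_{\ge 0}$ that is not identically zero (zero weights are allowed, but at least one edge has positive weight). For $E'\subseteq E$ let $w(E')=\sum_{e\in E'}w(e)$. Let $M^*(G)$ denote a matching of $G$ of maximum weight and $P^*(G)$ a perfect matching of $G$ of maximum weight among all perfect matchings. Define $\eta(G)=\min_{w} \frac{w(P^*(G))}{w(M^*(G))}$, the minimum over all such weight functions $w$. *)

theory Defs
  imports Complex_Main
begin

definition finite_graph :: "'a set \<Rightarrow> 'a set set \<Rightarrow> bool" where
  "finite_graph V E \<longleftrightarrow> finite V \<and> (\<forall>e\<in>E. e \<subseteq> V \<and> card e = 2)"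

text \<open>The graph without vertices does not count as connected.\<close>

definition connected_graph :: "'a set \<Rightarrow> 'a set set \<Rightarrow> bool" where
  "connected_graph V E \<longleftrightarrow> V \<noteq> {} \<and> (\<forall>u\<in>V. \<forall>v\<in>V. (u, v) \<in> {(x, y). {x, y} \<in> E}\<^sup>*)"

definition matching :: "'a set set \<Rightarrow> 'a set set \<Rightarrow> bool" where
  "matching E M \<longleftrightarrow> M \<subseteq> E \<and> (\<forall>e\<in>M. \<forall>f\<in>M. e \<noteq> f \<longrightarrow> e \<inter> f = {})"

definition perfect_matching :: "'a set \<Rightarrow> 'a set set \<Rightarrow> 'a set set \<Rightarrow> bool" where
  "perfect_matching V E M \<longleftrightarrow> matching E M \<and> \<Union>M = V"

text \<open>Weights are total functions, of which only the values on \<open>E\<close> matter.\<close>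

definition weight_function :: "'a set set \<Rightarrow> ('a set \<Rightarrow> real) \<Rightarrow> bool" where
  "weight_function E w \<longleftrightarrow> (\<forall>e\<in>E. 0 \<le> w e) \<and> (\<exists>e\<in>E. w e \<noteq> 0)"

definition max_matching :: "'a set set \<Rightarrow> ('a set \<Rightarrow> real) \<Rightarrow> 'a set set" where
  "max_matching E w = (ARG_MAX (sum w) M. matching E M)"

definition max_perfect_matching :: "'a set \<Rightarrow> 'a set set \<Rightarrow> ('a set \<Rightarrow> real) \<Rightarrow> 'a set set" where
  "max_perfect_matching V E w = (ARG_MAX (sum w) M. perfect_matching V E M)"

text \<open>
  The minimum is a genuine one for every finite graph that has an edge and a perfect
  matching: the quotient is invariant under scaling of \<open>w\<close>, and it is continuous on the
  compact set of weight functions of total weight 1, where the denominator is positive.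
\<close>

definition eta :: "'a set \<Rightarrow> 'a set set \<Rightarrow> real" where
  "eta V E = (LEAST r. \<exists>w. weight_function E w \<and>
     r = sum w (max_perfect_matching V E w) / sum w (max_matching E w))"

end

theory Submission imports Defs "HOL-Analysis.Function_Topology"
begin

text \<open>
  The quotient is invariant under scaling and continuous on the compact set of weight functions
  of total weight 1, so the minimum \<open>\<eta>\<close> is attained at some \<open>w\<close>.
  If \<open>\<eta> = 0\<close>, every perfect matching has weight 0 under this \<open>w\<close>, so no edge of
  positive weight lies in a perfect matching. Conversely, if \<open>e\<close> lies in no perfect matching,
  the indicator function of \<open>e\<close> has quotient 0.
\<close>

section \<open>Finite maxima and compactness in function spaces\<close>

lemma arg_max_eq_Max:
  fixes f :: "'b \<Rightarrow> 'c::linorder"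
  assumes "finite {x. P x}" "\<exists>x. P x"
  shows "f (ARG_MAX f x. P x) = Max (f ` {x. P x})"
proof -
  have "Max (f ` {x. P x}) \<in> f ` {x. P x}"
    using assms by (intro Max_in) auto
  then obtain x where x: "P x" "f x = Max (f ` {x. P x})" by auto
  have le: "f y \<le> f x" if "P y" for y
    using that assms x by simp
  have "f (ARG_MAX f x. P x) = f x"
    using x le by (intro arg_max_equality) auto
  then show ?thesis using x by simp
qed

lemma continuous_on_Max:
  fixes f :: "'i \<Rightarrow> 'b::topological_space \<Rightarrow> 'c::linorder_topology"
  assumes "finite I" "I \<noteq> {}" "\<And>i. i \<in> I \<Longrightarrow> continuous_on S (f i)"
  shows "continuous_on S (\<lambda>x. Max ((\<lambda>i. f i x) ` I))"
  using assms
  by (induction rule: finite_ne_induct) (auto intro!: continuous_on_max)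

text \<open>Tychonoff's theorem: the topology on a function type is the product topology, and the
  set is the product of the \<open>F i\<close> over all indices.\<close>

lemma compact_box_fun:
  fixes F :: "'i \<Rightarrow> 'b::topological_space set"
  assumes "\<And>i. compact (F i)"
  shows "compact {w. \<forall>i. w i \<in> F i}"
proof -
  have "compactin (product_topology (\<lambda>i. euclidean) UNIV) (PiE UNIV F)"
    using assms by (subst compactin_PiE) auto
  moreover have "PiE UNIV F = {w. \<forall>i. w i \<in> F i}"
    by auto
  ultimately show ?thesis
    by (simp add: euclidean_product_topology)
qed

text \<open>A closed slice of a compact box. Pinning the values outside \<open>E\<close> to 0 keeps
  the box compact although weights are total functions on a possibly infinite type.\<close>

lemma compact_simplex_fun:
  fixes E :: "'i set"
  assumes "finite E"
  shows "compact {w :: 'i \<Rightarrow> real. (\<forall>e\<in>E. 0 \<le> w e) \<and> (\<forall>e. e \<notin> E \<longrightarrow> w e = 0) \<and> sum w E = 1}"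
    (is "compact ?K")
proof -
  let ?B = "{w. \<forall>e. w e \<in> (if e \<in> E then {0..1::real} else {0})}"
  have "?K = ?B \<inter> {w. sum w E = 1}"
  proof (intro equalityI subsetI)
    fix w assume w: "w \<in> ?K"
    \<comment> \<open>A single nonnegative weight is bounded by the total weight 1.\<close>
    have "w e \<le> 1" if "e \<in> E" for e
      using w that assms member_le_sum[of e E w] by auto
    then show "w \<in> ?B \<inter> {w. sum w E = 1}" using w by auto
  next
    fix w assume w: "w \<in> ?B \<inter> {w. sum w E = 1}"
    have "0 \<le> w e" if "e \<in> E" for e
      using w that by (auto dest: spec[of _ e])
    moreover have "w e = 0" if "e \<notin> E" for e
      using w that by (auto dest: spec[of _ e])
    ultimately show "w \<in> ?K" using w by auto
  qed
  moreover have "compact ?B" by (rule compact_box_fun) simp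
  moreover have "closed {w. sum w E = (1::real)}"
    by (intro closed_Collect_eq continuous_intros continuous_on_product_coordinates)
  ultimately show ?thesis by (simp add: compact_Int_closed)
qed

section \<open>Matchings of maximum weight\<close>

lemma matching_subset: "matching E M \<Longrightarrow> M \<subseteq> E"
  by (simp add: matching_def)

lemma perfect_matching_subset: "perfect_matching V E M \<Longrightarrow> M \<subseteq> E"
  by (simp add: perfect_matching_def matching_subset)

lemma matching_singleton: "e \<in> E \<Longrightarrow> matching E {e}"
  by (simp add: matching_def)

lemma finite_matchings: "finite E \<Longrightarrow> finite {M. matching E M}"
  by (rule finite_subset[of _ "Pow E"]) (auto dest: matching_subset)

lemma finite_perfect_matchings: "finite E \<Longrightarrow> finite {M. perfect_matching V E M}"
  by (rule finite_subset[of _ "Pow E"]) (auto dest: perfect_matching_subset)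

text \<open>There are finitely many matchings, at least the empty one, so \<open>ARG_MAX\<close>
  picks a genuine maximizer. The form with \<open>Max\<close> is used because the maximal weight,
  unlike the chosen matching, depends continuously on \<open>w\<close>.\<close>

lemma sum_max_matching:
  assumes "finite E"
  shows "sum w (max_matching E w) = Max (sum w ` {M. matching E M})"
  unfolding max_matching_def
  by (rule arg_max_eq_Max[OF finite_matchings[OF assms]])
    (auto simp: matching_def intro!: exI[of _ "{}"])

lemma sum_max_perfect_matching:
  assumes "finite E" "\<exists>M. perfect_matching V E M"
  shows "sum w (max_perfect_matching V E w) = Max (sum w ` {M. perfect_matching V E M})"
  unfolding max_perfect_matching_def
  using arg_max_eq_Max[OF finite_perfect_matchings[OF assms(1)] assms(2)] .

lemma sum_le_max_matching:
  assumes "finite E" "matching E M"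
  shows "sum w M \<le> sum w (max_matching E w)"
  using assms by (simp add: sum_max_matching finite_matchings)

lemma sum_le_max_perfect_matching:
  assumes "finite E" "perfect_matching V E M"
  shows "sum w M \<le> sum w (max_perfect_matching V E w)"
proof -
  have "\<exists>M. perfect_matching V E M" using assms by blast
  with assms show ?thesis
    by (simp add: sum_max_perfect_matching finite_perfect_matchings)
qed

text \<open>The choice behind \<open>ARG_MAX\<close> is meaningful only if a maximizer exists;
  finiteness provides one.\<close>

lemma perfect_matching_max_perfect_matching:
  assumes "finite E" "\<exists>M. perfect_matching V E M"
  shows "perfect_matching V E (max_perfect_matching V E w)"
proof -
  have "Max (sum w ` {M. perfect_matching V E M}) \<in> sum w ` {M. perfect_matching V E M}"
    using assms by (intro Max_in) (auto simp: finite_perfect_matchings)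
  then obtain M where M: "perfect_matching V E M" "sum w M = Max (sum w ` {M. perfect_matching V E M})"
    by auto
  show ?thesis
    unfolding max_perfect_matching_def
    by (rule arg_maxI[where P = "perfect_matching V E", OF M(1)])
      (use assms M in \<open>auto simp: finite_perfect_matchings not_less\<close>)
qed

text \<open>An edge of positive weight is a matching by itself. Hence the denominator of the
  quotient never vanishes.\<close>

lemma max_matching_pos:
  assumes "finite E" "weight_function E w"
  shows "0 < sum w (max_matching E w)"
proof -
  obtain e where e: "e \<in> E" "0 < w e"
    using assms(2) by (force simp: weight_function_def order_less_le)
  then show ?thesis
    using sum_le_max_matching[OF assms(1) matching_singleton, of e w] by simp
qed

lemma max_perfect_matching_nonneg:
  assumes "finite E" "\<exists>M. perfect_matching V E M" "weight_function E w"
  shows "0 \<le> sum w (max_perfect_matching V E w)"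
  using perfect_matching_subset[OF perfect_matching_max_perfect_matching[OF assms(1,2)], of w] assms(3)
  by (auto simp: weight_function_def intro!: sum_nonneg)

section \<open>The quotient as a function of the weights\<close>

definition matching_ratio :: "'a set \<Rightarrow> 'a set set \<Rightarrow> ('a set \<Rightarrow> real) \<Rightarrow> real" where
  "matching_ratio V E w = sum w (max_perfect_matching V E w) / sum w (max_matching E w)"

text \<open>Multiplication by \<open>c\<close> is monotone and so commutes with \<open>Max\<close>.
  The two weights are related on \<open>E\<close> only, which lets a normalized weight be reset to 0
  elsewhere.\<close>

lemma Max_sum_scaled:
  fixes w :: "'b \<Rightarrow> real"
  assumes "finite \<M>" "\<M> \<noteq> {}" "0 \<le> c" "\<And>M. M \<in> \<M> \<Longrightarrow> M \<subseteq> E" "\<And>e. e \<in> E \<Longrightarrow> w' e = c * w e"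
  shows "Max (sum w' ` \<M>) = c * Max (sum w ` \<M>)"
proof -
  have "sum w' M = c * sum w M" if "M \<in> \<M>" for M
    unfolding sum_distrib_left using assms(4,5) that by (intro sum.cong) auto
  then have "sum w' ` \<M> = (*) c ` (sum w ` \<M>)"
    unfolding image_image by (intro image_cong) auto
  moreover have "mono ((*) c)"
    using assms(3) by (intro monoI mult_left_mono)
  ultimately show ?thesis
    using assms by (simp add: mono_Max_commute)
qed

lemma matching_ratio_scaled:
  assumes "finite E" "\<exists>M. perfect_matching V E M" "0 < c" "\<And>e. e \<in> E \<Longrightarrow> w' e = c * w e"
  shows "matching_ratio V E w' = matching_ratio V E w"
proof -
  have "sum w' (max_matching E w') = c * sum w (max_matching E w)"
    unfolding sum_max_matching[OF assms(1)]
    using assms by (intro Max_sum_scaled[where E = E])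
      (auto simp: finite_matchings matching_subset intro: exI[of _ "{}"] simp: matching_def)
  moreover have "sum w' (max_perfect_matching V E w') = c * sum w (max_perfect_matching V E w)"
    unfolding sum_max_perfect_matching[OF assms(1,2)]
    using assms by (intro Max_sum_scaled[where E = E])
      (auto simp: finite_perfect_matchings dest: perfect_matching_subset)
  ultimately show ?thesis using assms(3) by (simp add: matching_ratio_def)
qed

text \<open>Numerator and denominator are maxima of finitely many sums of coordinates, and
  coordinates are continuous in the product topology.\<close>

lemma continuous_on_matching_ratio:
  assumes "finite E" "\<exists>M. perfect_matching V E M" "\<And>w. w \<in> K \<Longrightarrow> weight_function E w"
  shows "continuous_on K (matching_ratio V E)"
proof -
  have "continuous_on K (\<lambda>w. Max (sum w ` {M. perfect_matching V E M}) / Max (sum w ` {M. matching E M}))"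
  proof (intro continuous_on_divide continuous_on_Max ballI)
    show "Max (sum w ` {M. matching E M}) \<noteq> 0" if "w \<in> K" for w
      using max_matching_pos[OF assms(1) assms(3)[OF that]] by (simp add: sum_max_matching assms(1))
    show "{M. matching E M} \<noteq> {}"
      by (auto simp: matching_def intro: exI[of _ "{}"])
    show "continuous_on K (\<lambda>w. sum w M)" for M :: "'a set set"
      by (intro continuous_intros continuous_on_subset[OF continuous_on_product_coordinates]) auto
    \<comment> \<open>The same goal arises for the numerator and for the denominator.\<close>
    then show "continuous_on K (\<lambda>w. sum w M)" for M :: "'a set set" .
  qed (use assms in \<open>auto simp: finite_matchings finite_perfect_matchings\<close>)
  then show ?thesis
    unfolding matching_ratio_def
    by (simp add: sum_max_matching sum_max_perfect_matching assms)
qed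

text \<open>The extreme value theorem gives a minimum on the simplex \<open>K\<close>; by scaling,
  every weight function has the same quotient as some member of \<open>K\<close>.\<close>

lemma matching_ratio_attains_min:
  assumes "finite E" "E \<noteq> {}" "\<exists>M. perfect_matching V E M"
  obtains w where "weight_function E w"
    "\<And>w'. weight_function E w' \<Longrightarrow> matching_ratio V E w \<le> matching_ratio V E w'"
proof -
  define K where "K = {w :: 'a set \<Rightarrow> real. (\<forall>e\<in>E. 0 \<le> w e) \<and> (\<forall>e. e \<notin> E \<longrightarrow> w e = 0) \<and> sum w E = 1}"
  have K_weight: "weight_function E w" if "w \<in> K" for w
  proof -
    have "sum w E \<noteq> 0" using that by (simp add: K_def)
    then have "\<exists>e\<in>E. w e \<noteq> 0" by (meson sum.neutral)
    with that show ?thesis by (simp add: K_def weight_function_def)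
  qed
  have normalize: "\<exists>w\<in>K. matching_ratio V E w = matching_ratio V E w'"
    if w': "weight_function E w'" for w'
  proof -
    \<comment> \<open>A nonnegative weight with total 0 would vanish on all of
      \<open>E\<close>.\<close>
    have pos: "0 < sum w' E"
      using w' assms(1) unfolding weight_function_def
      by (metis order_less_le sum_nonneg sum_nonneg_eq_0_iff)
    define w where "w e = (if e \<in> E then inverse (sum w' E) * w' e else 0)" for e
    have "sum w E = inverse (sum w' E) * sum w' E"
      unfolding sum_distrib_left w_def by (intro sum.cong) auto
    then have "sum w E = 1" using pos by simp
    then have "w \<in> K"
      using pos w' by (auto simp: K_def w_def weight_function_def)
    moreover have "matching_ratio V E w = matching_ratio V E w'"
      using assms pos by (intro matching_ratio_scaled[where c = "inverse (sum w' E)"]) (auto simp: w_def)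
    ultimately show ?thesis by blast
  qed
  have "weight_function E (\<lambda>_. 1)" using assms(2) by (auto simp: weight_function_def)
  then have "K \<noteq> {}" using normalize by blast
  moreover have "compact K"
    unfolding K_def by (rule compact_simplex_fun[OF assms(1)])
  moreover have "continuous_on K (matching_ratio V E)"
    using assms K_weight by (intro continuous_on_matching_ratio) auto
  ultimately obtain w where w: "w \<in> K" "\<forall>w'\<in>K. matching_ratio V E w \<le> matching_ratio V E w'"
    by (meson continuous_attains_inf)
  show thesis
    using w normalize K_weight that by metis
qed

text \<open>On the reals, \<open>LEAST\<close> has its intended value only if a least element
  exists; the attained minimum is that element.\<close>

lemma eta_attained:
  assumes "finite E" "E \<noteq> {}" "\<exists>M. perfect_matching V E M"
  obtains w where "weight_function E w" "eta V E = matching_ratio V E w"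
    "\<And>w'. weight_function E w' \<Longrightarrow> eta V E \<le> matching_ratio V E w'"
proof -
  obtain w where w: "weight_function E w"
    "\<And>w'. weight_function E w' \<Longrightarrow> matching_ratio V E w \<le> matching_ratio V E w'"
    using matching_ratio_attains_min[OF assms] by blast
  have "eta V E = matching_ratio V E w"
    unfolding eta_def matching_ratio_def[symmetric]
    using w by (intro Least_equality) auto
  with w that show thesis by simp
qed

section \<open>Vanishing minimum and edges in no perfect matching\<close>

theorem theorem2p2:
  fixes V :: "'a set" and E :: "'a set set"
  assumes "finite_graph V E"
    and "connected_graph V E"
    and "\<exists>M. perfect_matching V E M"
  shows "eta V E = 0 \<longleftrightarrow> (\<exists>e\<in>E. \<not> (\<exists>M. perfect_matching V E M \<and> e \<in> M))"
proof -
  have fin: "finite E"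
    using assms(1) by (auto simp: finite_graph_def intro!: finite_subset[of E "Pow V"])
  \<comment> \<open>Connectedness supplies a vertex, which a perfect matching covers by an
    edge.\<close>
  have "E \<noteq> {}"
    using assms(2,3) by (auto simp: connected_graph_def perfect_matching_def matching_def)
  then obtain w where w: "weight_function E w" "eta V E = matching_ratio V E w"
    and eta_le: "\<And>w'. weight_function E w' \<Longrightarrow> eta V E \<le> matching_ratio V E w'"
    using eta_attained[OF fin _ assms(3)] by blast
  have w_nonneg: "0 \<le> w e" if "e \<in> E" for e
    using w(1) that by (simp add: weight_function_def)
  show ?thesis
  proof
    assume "eta V E = 0"
    \<comment> \<open>The denominator is positive, so a zero quotient means a zero
      numerator.\<close>
    then have zero: "sum w (max_perfect_matching V E w) = 0"
      using w max_matching_pos[OF fin w(1)] by (simp add: matching_ratio_def)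
    obtain e where e: "e \<in> E" "w e \<noteq> 0"
      using w(1) by (auto simp: weight_function_def)
    have "e \<notin> M" if M: "perfect_matching V E M" for M
    proof
      assume "e \<in> M"
      have "M \<subseteq> E" by (rule perfect_matching_subset[OF M])
      then have "w e \<le> sum w M"
        using \<open>e \<in> M\<close> fin w_nonneg by (intro member_le_sum) (auto intro: finite_subset)
      also have "\<dots> \<le> 0"
        using sum_le_max_perfect_matching[OF fin M, of w] zero by simp
      finally show False using e w_nonneg[of e] by simp
    qed
    with e show "\<exists>e\<in>E. \<not> (\<exists>M. perfect_matching V E M \<and> e \<in> M)" by blast
  next
    assume "\<exists>e\<in>E. \<not> (\<exists>M. perfect_matching V E M \<and> e \<in> M)"
    then obtain e where e: "e \<in> E" "\<And>M. perfect_matching V E M \<Longrightarrow> e \<notin> M" by blast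
    define w' :: "'a set \<Rightarrow> real" where "w' f = (if f = e then 1 else 0)" for f
    have "weight_function E w'" using e(1) by (auto simp: weight_function_def w'_def)
    \<comment> \<open>The selected matching is perfect, so it misses \<open>e\<close>, the only edge
      with nonzero weight.\<close>
    moreover have "sum w' (max_perfect_matching V E w') = 0"
      using e(2)[OF perfect_matching_max_perfect_matching[OF fin assms(3)], of w']
      by (intro sum.neutral) (auto simp: w'_def)
    ultimately have "eta V E \<le> 0"
      using eta_le[of w'] by (simp add: matching_ratio_def)
    \<comment> \<open>The minimum is a value of the quotient, and all such values are
      nonnegative.\<close>
    moreover have "0 \<le> eta V E"
      using w max_matching_pos[OF fin w(1)] max_perfect_matching_nonneg[OF fin assms(3) w(1)]
      by (simp add: matching_ratio_def)
    ultimately show "eta V E = 0" by simp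
  qed
qed

end
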